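(* Let $I\subseteq\mathbb{R}_+$ be a non-empty, non-singleton interval with $0\in I$. (1) Let $\Phi:[0,\ell(I)]\to\mathbb{R}_+$ be subadditive. If $g:I\to\mathbb{R}$ is nondecreasing, then $f:=g-\Phi$ is $\Phi$-monotone on $I$. (2) Conversely, let $\Phi:[0,\ell(I)]\to\mathbb{R}_+$ be subadditive and concave and let $f:I\to\mathbb{R}$ be $\Phi$-monotone. Then there exists a nondecreasing majorant $g:I\to\mathbb{R}$ of $f$ such that for all $x\in I$, $$\Phi(x)\le g(x)-f(x)\le 2\Phi\Big(\frac{x}{2}\Big).$$
   Context: $\mathbb{R}_+=[0,\infty)$. $\ell(I)\in[0,\infty]$ is the length of $I$; if $\ell(I)=\infty$, then $[0,\ell(I)]$ is read as $[0,\infty)$. $\Phi$ is subadditive if $\Phi(u+v)\le\Phi(u)+\Phi(v)$ whenever $u,v,u+v$ lie in its domain. A function $f:I\to\mathbb{R}$ is $\Phi$-monotone if $f(x)\le f(y)+\Phi(y-x)$ for all $x,y\in I$ with $x\le y$. A majorant of $f$ is a function $g$ with $g\ge f$ on $I$. *)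

theory Defs
  imports "HOL-Analysis.Analysis"
begin

(* The length of a non-empty interval, with values in [0, \<infinity>]. *)
definition interval_length :: "real set \<Rightarrow> ereal" where
  "interval_length I = (SUP x\<in>I. ereal x) - (INF x\<in>I. ereal x)"

(* The real interval [0, l(I)]; it is [0, \<infinity>) when l(I) = \<infinity>.
   The endpoint l(I) belongs to it even when I is not closed. *)
definition error_domain :: "real set \<Rightarrow> real set" where
  "error_domain I = {u. 0 \<le> u \<and> ereal u \<le> interval_length I}"

definition subadditive_on :: "real set \<Rightarrow> (real \<Rightarrow> real) \<Rightarrow> bool" where
  "subadditive_on D \<Phi> \<longleftrightarrow>
    (\<forall>u\<in>D. \<forall>v\<in>D. u + v \<in> D \<longrightarrow> \<Phi> (u + v) \<le> \<Phi> u + \<Phi> v)"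

definition phi_monotone_on :: "real set \<Rightarrow> (real \<Rightarrow> real) \<Rightarrow> (real \<Rightarrow> real) \<Rightarrow> bool" where
  "phi_monotone_on I \<Phi> f \<longleftrightarrow>
    (\<forall>x\<in>I. \<forall>y\<in>I. x \<le> y \<longrightarrow> f x \<le> f y + \<Phi> (y - x))"

definition majorant_on :: "real set \<Rightarrow> (real \<Rightarrow> real) \<Rightarrow> (real \<Rightarrow> real) \<Rightarrow> bool" where
  "majorant_on I f g \<longleftrightarrow> (\<forall>x\<in>I. f x \<le> g x)"

end

theory Submission
  imports Defs
begin

text \<open>
  In the second part, take \<open>g x = (SUP u\<in>I \<inter> {..x}. f u + \<Phi> u)\<close>, the least nondecreasing function
  above \<open>f + \<Phi>\<close>. For \<open>u \<le> x\<close>, \<open>\<Phi>\<close>-monotonicity and concavity at the midpoint of \<open>u\<close> and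
  \<open>x - u\<close> give \<open>f u + \<Phi> u \<le> f x + \<Phi> (x - u) + \<Phi> u \<le> f x + 2 * \<Phi> (x / 2)\<close>.
\<close>

text \<open>Since 0 is the least element of \<open>I\<close>, the length of \<open>I\<close> is its
  supremum, which is at least \<open>x\<close>. This puts every argument at which \<Phi> is used
  below inside its domain.\<close>

lemma error_domain_memI:
  assumes "I \<subseteq> {0..}" "0 \<in> I" "x \<in> I" "0 \<le> u" "u \<le> x"
  shows "u \<in> error_domain I"
proof -
  have "(INF x\<in>I. ereal x) = 0"
    using assms by (intro antisym INF_greatest INF_lower2[of 0]) auto
  moreover have "ereal u \<le> (SUP x\<in>I. ereal x)"
    using assms by (intro SUP_upper2[of x]) auto
  ultimately show ?thesis
    using assms by (simp add: error_domain_def interval_length_def)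
qed

lemma concave_on_midpoint:
  fixes h :: "real \<Rightarrow> real"
  assumes "concave_on D h" "a \<in> D" "b \<in> D"
  shows "h a + h b \<le> 2 * h ((a + b) / 2)"
proof -
  have "h ((1/2) *\<^sub>R a + (1/2) *\<^sub>R b) \<ge> (1/2) * h a + (1/2) * h b"
    using assms unfolding concave_on_iff by (smt (verit) field_sum_of_halves half_gt_zero_iff)
  then show ?thesis
    by (simp add: add_divide_distrib)
qed

text \<open>Splitting y as x + (y - x), subadditivity bounds the increase of \<Phi> from x to y by
  \<Phi> (y - x), which is exactly the error that \<Phi>-monotonicity allows.\<close>

lemma phi_monotone_on_mono_diff:
  assumes I: "I \<subseteq> {0..}" "0 \<in> I"
    and sub: "subadditive_on (error_domain I) \<Phi>"
    and g: "mono_on I g"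
  shows "phi_monotone_on I \<Phi> (\<lambda>x. g x - \<Phi> x)"
  unfolding phi_monotone_on_def
proof (intro ballI impI)
  fix x y assume xy: "x \<in> I" "y \<in> I" "x \<le> y"
  have "0 \<le> x"
    using xy I by auto
  then have "x \<in> error_domain I" "y - x \<in> error_domain I" "x + (y - x) \<in> error_domain I"
    using xy by (auto intro!: error_domain_memI[OF I, of y])
  then have "\<Phi> (x + (y - x)) \<le> \<Phi> x + \<Phi> (y - x)"
    using sub unfolding subadditive_on_def by blast
  moreover have "g x \<le> g y"
    using g xy by (auto dest: mono_onD)
  ultimately show "g x - \<Phi> x \<le> g y - \<Phi> y + \<Phi> (y - x)"
    by simp
qed

lemma phi_monotone_on_mono_majorant:
  assumes I: "I \<subseteq> {0..}" "0 \<in> I"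
    and nonneg: "\<Phi> \<in> error_domain I \<rightarrow> {0..}"
    and conc: "concave_on (error_domain I) \<Phi>"
    and f: "phi_monotone_on I \<Phi> f"
  shows "\<exists>g :: real \<Rightarrow> real. mono_on I g \<and> majorant_on I f g \<and>
           (\<forall>x\<in>I. \<Phi> x \<le> g x - f x \<and> g x - f x \<le> 2 * \<Phi> (x / 2))"
proof -
  define g where "g x = (SUP u\<in>I \<inter> {..x}. f u + \<Phi> u)" for x
  \<comment> \<open>The right-hand side is free of \<open>u\<close>, because \<open>u\<close> and
    \<open>x - u\<close> always have midpoint \<open>x / 2\<close>. So it serves twice: it makes the
    supremum a genuine real one, and it bounds \<open>g x\<close> from above.\<close>
  have bound: "f u + \<Phi> u \<le> f x + 2 * \<Phi> (x / 2)" if "x \<in> I" "u \<in> I \<inter> {..x}" for u x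
  proof -
    have "0 \<le> u"
      using that I by auto
    then have "x - u \<in> error_domain I" "u \<in> error_domain I"
      using that by (auto intro!: error_domain_memI[OF I, of x])
    from concave_on_midpoint[OF conc this] have "\<Phi> (x - u) + \<Phi> u \<le> 2 * \<Phi> (x / 2)"
      by simp
    moreover have "f u \<le> f x + \<Phi> (x - u)"
      using f that by (auto simp: phi_monotone_on_def)
    ultimately show ?thesis
      by simp
  qed
  have bdd: "bdd_above ((\<lambda>u. f u + \<Phi> u) ` (I \<inter> {..x}))" if "x \<in> I" for x
    using bound[OF that] by (intro bdd_aboveI2)
  \<comment> \<open>The index u = x is admissible in the supremum.\<close>
  have lower: "f x + \<Phi> x \<le> g x" if "x \<in> I" for x
    unfolding g_def using that by (intro cSUP_upper bdd) auto
  have upper: "g x \<le> f x + 2 * \<Phi> (x / 2)" if "x \<in> I" for x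
    unfolding g_def using that bound by (intro cSUP_least) auto
  \<comment> \<open>The index set \<open>I \<inter> {..x}\<close> grows with \<open>x\<close>, and
    for \<open>x\<close> in \<open>I\<close> it is non-empty, as it contains
    \<open>x\<close>.\<close>
  have "mono_on I g"
    unfolding g_def by (intro mono_onI cSUP_subset_mono bdd) auto
  moreover have "\<Phi> x \<ge> 0" if "x \<in> I" for x
  proof -
    have "x \<in> error_domain I"
      using that I by (auto intro!: error_domain_memI[OF I that])
    then show ?thesis
      using nonneg by auto
  qed
  \<comment> \<open>Nonnegativity of \<Phi> gives f x \<le> f x + \<Phi> x \<le> g x.\<close>
  then have "majorant_on I f g"
    unfolding majorant_on_def using lower by fastforce
  moreover have "\<forall>x\<in>I. \<Phi> x \<le> g x - f x \<and> g x - f x \<le> 2 * \<Phi> (x / 2)"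
    using lower upper by (simp add: algebra_simps)
  ultimately show ?thesis
    by blast
qed

theorem theorem2p3:
  fixes I :: "real set"
  assumes "is_interval I"
    and "I \<subseteq> {0..}"
    and "I \<noteq> {}"
    and "\<not> is_singleton I"
    and "0 \<in> I"
  shows
    "(\<forall>\<Phi> :: real \<Rightarrow> real. \<forall>g :: real \<Rightarrow> real.
        \<Phi> \<in> error_domain I \<rightarrow> {0..} \<longrightarrow>
        subadditive_on (error_domain I) \<Phi> \<longrightarrow>
        mono_on I g \<longrightarrow>
        phi_monotone_on I \<Phi> (\<lambda>x. g x - \<Phi> x)) \<and>
     (\<forall>\<Phi> :: real \<Rightarrow> real. \<forall>f :: real \<Rightarrow> real.
        \<Phi> \<in> error_domain I \<rightarrow> {0..} \<longrightarrow>
        subadditive_on (error_domain I) \<Phi> \<longrightarrow>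
        concave_on (error_domain I) \<Phi> \<longrightarrow>
        phi_monotone_on I \<Phi> f \<longrightarrow>
        (\<exists>g :: real \<Rightarrow> real.
           mono_on I g \<and> majorant_on I f g \<and>
           (\<forall>x\<in>I. \<Phi> x \<le> g x - f x \<and> g x - f x \<le> 2 * \<Phi> (x / 2))))"
  using phi_monotone_on_mono_diff[OF assms(2,5)] phi_monotone_on_mono_majorant[OF assms(2,5)]
  by blast

end
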